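(* Let $N\ge1$, $d\ge2$, $\boldsymbol p=(p_1,\dots,p_d)$ with $p_j>0$, $\sum_jp_j=1$. Let $\{\xi_j\}_{j=1}^N$, $\{\eta_j\}_{j=1}^N$ be two independent sequences of independent (multinomial) trials with $P(\xi_j=l)=p_l$, $P(\eta_j=l)=p_l$ for $l=1,\dots,d$, $j=1,\dots,N$. Denote by $\boldsymbol X,\boldsymbol Y$ the multinomial count vectors of the two sequences. Let $$M=\{(\xi_j,\eta_j):\xi_j=\eta_j,\ j=1,\dots,N\}$$ be the collection (indexed by the trial number $j$) of matched pairs. Choose $0<q\le\min_{1\le k\le d}p_k$, and let $\{B_{jk}\}_{1\le j\le N,1\le k\le d}$ be an array of independent Bernoulli trials, independent of the two sequences, such that for each $j$, $P(B_{jk}=1)=\tau_k:=q/p_k$. Thin $M$ to $$R=\{(\xi_j,\eta_j):(\xi_j,\eta_j)\in M\text{ and }B_{j\xi_j}=1,\ j=1,\dots,N\}.$$ Let $p=1-q$ and let $Z$ be a random variable with distribution $\varphi_{\boldsymbol x,\boldsymbol y}$, where $\boldsymbol x,\boldsymbol y$ are in the support of the multinomial $(N,\boldsymbol p)$ distribution. Then $N-Z$ is distributed as the number of elements (trials $j$) in the thinned match set $R$, conditional on $\boldsymbol X=\boldsymbol x$, $\boldsymbol Y=\boldsymbol y$.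
   Context: The measure $\varphi_{\boldsymbol x,\boldsymbol y}$ is the probability distribution $\varphi_{\boldsymbol x,\boldsymbol y}(z)=\binom Nzp^zq^{N-z}\sum_{n=0}^NQ_n(z;N,p)Q_n(\boldsymbol x,\boldsymbol y;N,\boldsymbol p)$, $z=0,\dots,N$ (non-negative when $q\le\min_jp_j$), where: (i) $Q_n(x;N,p)=\sum_\nu(-q/p)^\nu\binom x\nu\binom{N-x}{n-\nu}/\binom Nn$, $q=1-p$, are the one-dimensional Krawtchouk polynomials; (ii) $Q_n(\boldsymbol x,\boldsymbol y;N,\boldsymbol p)$ are the reproducing kernel polynomials on the multinomial distribution $m(\boldsymbol x;N,\boldsymbol p)=\frac{N!}{\prod_jx_j!}\prod_jp_j^{x_j}$, $\boldsymbol x\in\mathbb Z_+^d$, $|\boldsymbol x|=\sum_jx_j=N$: choose real functions $u^{(0)}\equiv1,\dots,u^{(d-1)}$ on $\{1,\dots,d\}$ with $\sum_ju^{(k)}_ju^{(l)}_jp_j=\delta_{kl}$; for $\boldsymbol n\in\mathbb Z_+^{d-1}$, $|\boldsymbol n|\le N$, let $Q_{\boldsymbol n}(\boldsymbol x;\boldsymbol u)$ be the coefficient of $w_1^{n_1}\cdots w_{d-1}^{n_{d-1}}$ in $\prod_{j=1}^d(1+\sum_{l=1}^{d-1}w_lu^{(l)}_j)^{x_j}$ (orthogonal on the multinomial with squared norm $\frac{N!}{n_1!\cdots n_{d-1}!(N-|\boldsymbol n|)!}$), let $Q^\circ_{\boldsymbol n}$ be their unit-norm scalings, and set $Q_n(\boldsymbol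 x,\boldsymbol y;N,\boldsymbol p)=\sum_{|\boldsymbol n|=n}Q^\circ_{\boldsymbol n}(\boldsymbol x;\boldsymbol u)Q^\circ_{\boldsymbol n}(\boldsymbol y;\boldsymbol u)$, independent of the choice of $\boldsymbol u$. *)

theory Defs
  imports "HOL-Probability.Probability" "HOL-Library.Poly_Mapping"
begin

text \<open>
  The \<open>d\<close> categories are the elements of a finite type \<open>'d\<close>, so \<open>d = CARD('d)\<close>.
\<close>

definition multinomial_support :: "nat \<Rightarrow> ('d::finite \<Rightarrow> nat) set" where
  "multinomial_support N = {x. (\<Sum>j\<in>UNIV. x j) = N}"

text \<open>Multinomial probabilities, meant for \<open>x \<in> multinomial_support N\<close>.\<close>

definition multinomial_mass :: "nat \<Rightarrow> ('d::finite \<Rightarrow> real) \<Rightarrow> ('d \<Rightarrow> nat) \<Rightarrow> real" where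
  "multinomial_mass N p x =
     fact N / (\<Prod>j\<in>UNIV. fact (x j)) * (\<Prod>j\<in>UNIV. p j ^ x j)"

definition krawtchouk :: "nat \<Rightarrow> nat \<Rightarrow> real \<Rightarrow> nat \<Rightarrow> real" where
  "krawtchouk n N p x =
     (\<Sum>\<nu>\<le>n. (- ((1 - p) / p)) ^ \<nu> * real (x choose \<nu>) * real ((N - x) choose (n - \<nu>)))
       / real (N choose n)"

text \<open>Only \<open>u k\<close> with \<open>k < CARD('d)\<close> is relevant.\<close>

definition orthonormal_system :: "('d::finite \<Rightarrow> real) \<Rightarrow> (nat \<Rightarrow> 'd \<Rightarrow> real) \<Rightarrow> bool" where
  "orthonormal_system p u \<longleftrightarrow>
     (\<forall>j. u 0 j = 1) \<and>
     (\<forall>k<CARD('d). \<forall>l<CARD('d). (\<Sum>j\<in>UNIV. u k j * u l j * p j) = (if k = l then 1 else 0))"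

text \<open>
  Polynomials in the indeterminates \<open>w\<^sub>1, w\<^sub>2, \<dots>\<close> are finitely supported maps from monomials
  (finitely supported exponent maps) to coefficients;
  \<open>single (single l 1) c\<close> is the term \<open>c w\<^sub>l\<close>.
\<close>

definition krawtchouk_genpoly ::
    "(nat \<Rightarrow> 'd::finite \<Rightarrow> real) \<Rightarrow> ('d \<Rightarrow> nat) \<Rightarrow> (nat \<Rightarrow>\<^sub>0 nat) \<Rightarrow>\<^sub>0 real" where
  "krawtchouk_genpoly u x =
     (\<Prod>j\<in>UNIV. (1 + (\<Sum>l\<in>{1..CARD('d) - 1}.
        Poly_Mapping.single (Poly_Mapping.single l 1) (u l j))) ^ x j)"

definition multi_krawtchouk ::
    "(nat \<Rightarrow> 'd::finite \<Rightarrow> real) \<Rightarrow> (nat \<Rightarrow>\<^sub>0 nat) \<Rightarrow> ('d \<Rightarrow> nat) \<Rightarrow> real" where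
  "multi_krawtchouk u n x = Poly_Mapping.lookup (krawtchouk_genpoly u x) n"

definition multi_krawtchouk_normalized ::
    "nat \<Rightarrow> ('d::finite \<Rightarrow> real) \<Rightarrow> (nat \<Rightarrow> 'd \<Rightarrow> real) \<Rightarrow> (nat \<Rightarrow>\<^sub>0 nat) \<Rightarrow> ('d \<Rightarrow> nat) \<Rightarrow> real" where
  "multi_krawtchouk_normalized N p u n x =
     multi_krawtchouk u n x /
     sqrt (\<Sum>x'\<in>multinomial_support N. multinomial_mass N p x' * (multi_krawtchouk u n x')\<^sup>2)"

text \<open>The exponents \<open>(n\<^sub>1, \<dots>, n\<^bsub>d-1\<^esub>)\<close> of total degree \<open>n\<close>.\<close>

definition multi_degrees :: "nat \<Rightarrow> nat \<Rightarrow> (nat \<Rightarrow>\<^sub>0 nat) set" where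
  "multi_degrees d n =
     {\<nu>. Poly_Mapping.keys \<nu> \<subseteq> {1..d - 1} \<and> (\<Sum>l\<in>{1..d - 1}. Poly_Mapping.lookup \<nu> l) = n}"

definition kernel_polynomial ::
    "nat \<Rightarrow> ('d::finite \<Rightarrow> real) \<Rightarrow> (nat \<Rightarrow> 'd \<Rightarrow> real) \<Rightarrow> nat \<Rightarrow> ('d \<Rightarrow> nat) \<Rightarrow> ('d \<Rightarrow> nat) \<Rightarrow> real" where
  "kernel_polynomial N p u n x y =
     (\<Sum>\<nu>\<in>multi_degrees CARD('d) n.
        multi_krawtchouk_normalized N p u \<nu> x * multi_krawtchouk_normalized N p u \<nu> y)"

text \<open>
  The mass function \<open>\<phi>\<^bsub>x,y\<^esub>\<close>, written in terms of \<open>q\<close> with success probability \<open>1 - q\<close>. It vanishes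
  for \<open>z > N\<close> because of the binomial coefficient.
\<close>

definition phi ::
    "nat \<Rightarrow> ('d::finite \<Rightarrow> real) \<Rightarrow> (nat \<Rightarrow> 'd \<Rightarrow> real) \<Rightarrow> real \<Rightarrow> ('d \<Rightarrow> nat) \<Rightarrow> ('d \<Rightarrow> nat) \<Rightarrow> nat \<Rightarrow> real" where
  "phi N p u q x y z =
     real (N choose z) * (1 - q) ^ z * q ^ (N - z) *
     (\<Sum>n\<le>N. krawtchouk n N (1 - q) z * kernel_polynomial N p u n x y)"

definition count_vector :: "nat \<Rightarrow> (nat \<Rightarrow> 'a \<Rightarrow> 'd) \<Rightarrow> 'a \<Rightarrow> 'd \<Rightarrow> nat" where
  "count_vector N \<xi> \<omega> l = card {j \<in> {1..N}. \<xi> j \<omega> = l}"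

text \<open>The collections of matched and of thinned pairs, represented by their trial numbers.\<close>

definition matched_trials ::
    "nat \<Rightarrow> (nat \<Rightarrow> 'a \<Rightarrow> 'd) \<Rightarrow> (nat \<Rightarrow> 'a \<Rightarrow> 'd) \<Rightarrow> 'a \<Rightarrow> nat set" where
  "matched_trials N \<xi> \<eta> \<omega> = {j \<in> {1..N}. \<xi> j \<omega> = \<eta> j \<omega>}"

definition thinned_trials ::
    "nat \<Rightarrow> (nat \<Rightarrow> 'a \<Rightarrow> 'd) \<Rightarrow> (nat \<Rightarrow> 'a \<Rightarrow> 'd) \<Rightarrow> (nat \<Rightarrow> 'd \<Rightarrow> 'a \<Rightarrow> bool) \<Rightarrow> 'a \<Rightarrow> nat set" where
  "thinned_trials N \<xi> \<eta> B \<omega> = {j \<in> matched_trials N \<xi> \<eta> \<omega>. B j (\<xi> j \<omega>) \<omega>}"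

text \<open>
  Independence of two random elements with values in possibly different measurable spaces
  (\<open>indep_var\<close> requires both to have the same value type).
\<close>

definition independent_elements ::
    "'a measure \<Rightarrow> 'b measure \<Rightarrow> ('a \<Rightarrow> 'b) \<Rightarrow> 'c measure \<Rightarrow> ('a \<Rightarrow> 'c) \<Rightarrow> bool" where
  "independent_elements M S X T Y \<longleftrightarrow>
     X \<in> measurable M S \<and> Y \<in> measurable M T \<and>
     prob_space.indep_set M (sets (vimage_algebra (space M) X S)) (sets (vimage_algebra (space M) Y T))"

definition trial_sequence :: "nat \<Rightarrow> (nat \<Rightarrow> 'a \<Rightarrow> 'd) \<Rightarrow> 'a \<Rightarrow> nat \<Rightarrow> 'd" where
  "trial_sequence N \<xi> \<omega> = (\<lambda>j\<in>{1..N}. \<xi> j \<omega>)"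

definition coin_array :: "nat \<Rightarrow> (nat \<Rightarrow> 'd \<Rightarrow> 'a \<Rightarrow> bool) \<Rightarrow> 'a \<Rightarrow> nat \<times> 'd \<Rightarrow> bool" where
  "coin_array N B \<omega> = (\<lambda>(j, k)\<in>{1..N} \<times> UNIV. B j k \<omega>)"

abbreviation sequence_space :: "nat \<Rightarrow> (nat \<Rightarrow> 'd) measure" where
  "sequence_space N \<equiv> PiM {1..N} (\<lambda>_. count_space UNIV)"

abbreviation array_space :: "nat \<Rightarrow> (nat \<times> 'd \<Rightarrow> bool) measure" where
  "array_space N \<equiv> PiM ({1..N} \<times> UNIV) (\<lambda>_. count_space UNIV)"

end

theory Submission
  imports Defs
begin

text \<open>
  Both sides are lifted to sequences of trials. Completeness of the orthonormal system gives
  \<open>1 + t [k = l] / p\<^sub>k = (1 + t) + t \<Sum>\<^bsub>r\<ge>1\<^esub> u\<^sup>r\<^sub>k u\<^sup>r\<^sub>l\<close>, and with \<open>t = q (s - 1)\<close>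
  the left-hand side is the factor that one trial with outcome \<open>(k, l)\<close> contributes to the generating
  function of the number of thinned matches. Multiplying over the trials and expanding yields a sum
  over index sequences \<open>h\<close>, with weight \<open>(1 + t)\<^bsup>N-n\<^esup> t\<^sup>n\<close> where \<open>n\<close> is the number of nonzero indices.
  Summing over all outcome sequences with counts \<open>x\<close> and \<open>y\<close> makes the contribution of \<open>h\<close>
  depend only on its type \<open>\<nu>\<close>, and it becomes the product of the normalized polynomials with index
  \<open>\<nu>\<close>. The result is \<open>\<Sum>\<^sub>n (1 + t)\<^bsup>N-n\<^esup> t\<^sup>n Q\<^sub>n(x, y)\<close>, which is also the generating function of
  \<open>N - Z\<close>, because \<open>(1 + t)\<^bsup>N-n\<^esup> t\<^sup>n\<close> is the transform of the one-dimensional Krawtchouk polynomial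
  \<open>Q\<^sub>n\<close> under the binomial distribution.
\<close>

subsection \<open>Sequences with prescribed counts\<close>

text \<open>The index set is arbitrary, rather than \<open>{1..N}\<close>, so that induction on it
  is possible. The extensional function space fixes the values outside \<open>I\<close>, which keeps
  the set finite.\<close>

definition words :: "'i set \<Rightarrow> ('d \<Rightarrow> nat) \<Rightarrow> ('i \<Rightarrow> 'd) set" where
  "words I x = {f \<in> I \<rightarrow>\<^sub>E UNIV. \<forall>l. card {i\<in>I. f i = l} = x l}"

lemma finite_words:
  fixes x :: "'d::finite \<Rightarrow> nat"
  assumes "finite I" shows "finite (words I x)"
  by (rule finite_subset[of _ "I \<rightarrow>\<^sub>E UNIV"]) (auto simp: words_def assms intro!: finite_PiE)

lemma prod_words:
  fixes x :: "'d::finite \<Rightarrow> nat" and h :: "'d \<Rightarrow> 'c::comm_monoid_mult"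
  assumes "finite I" "f \<in> words I x"
  shows "(\<Prod>i\<in>I. h (f i)) = (\<Prod>j\<in>UNIV. h j ^ x j)"
proof -
  have "(\<Prod>i\<in>I. h (f i)) = (\<Prod>j\<in>UNIV. \<Prod>i\<in>{i\<in>I. f i = j}. h (f i))"
    using assms by (intro prod.group[symmetric]) auto
  also have "\<dots> = (\<Prod>j\<in>UNIV. h j ^ x j)"
    using assms by (intro prod.cong) (auto simp: words_def)
  finally show ?thesis .
qed

lemma finite_multinomial_support: "finite (multinomial_support N :: ('d::finite \<Rightarrow> nat) set)"
proof (rule finite_subset)
  show "(multinomial_support N :: ('d \<Rightarrow> nat) set) \<subseteq> UNIV \<rightarrow>\<^sub>E {..N}"
    by (auto simp: multinomial_support_def intro!: member_le_sum)
qed (auto intro!: finite_PiE)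

lemma sum_words:
  fixes F :: "('i \<Rightarrow> 'd::finite) \<Rightarrow> 'c::comm_monoid_add"
  assumes "finite I"
  shows "(\<Sum>f\<in>I \<rightarrow>\<^sub>E UNIV. F f) = (\<Sum>x\<in>multinomial_support (card I). \<Sum>f\<in>words I x. F f)"
proof -
  have "(\<Sum>l\<in>UNIV. card {i\<in>I. f i = l}) = card I" for f :: "'i \<Rightarrow> 'd"
    using sum.group[of I UNIV f "\<lambda>_. 1::nat"] assms by simp
  then have "(\<Sum>f\<in>I \<rightarrow>\<^sub>E UNIV. F f) = (\<Sum>x\<in>multinomial_support (card I).
        \<Sum>f\<in>{f\<in>I \<rightarrow>\<^sub>E UNIV. (\<lambda>l. card {i\<in>I. f i = l}) = x}. F f)"
    using assms by (intro sum.group[symmetric] finite_multinomial_support finite_PiE)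
      (auto simp: multinomial_support_def)
  then show ?thesis by (simp add: words_def fun_eq_iff)
qed

text \<open>Multinomial coefficient, by the recurrence that splits sequences according to the
  outcome at one position \<open>a\<close>: outcome \<open>l\<close> accounts for the fraction
  \<open>x l / card (insert a I)\<close> of them.\<close>

lemma card_words:
  fixes I :: "'i set" and x :: "'d::finite \<Rightarrow> nat"
  assumes "finite I" "x \<in> multinomial_support (card I)"
  shows "real (card (words I x)) = fact (card I) / (\<Prod>j\<in>UNIV. fact (x j))"
  using assms
proof (induction I arbitrary: x rule: finite_induct)
  case empty
  then have x: "x = (\<lambda>_. 0)"
    by (auto simp: multinomial_support_def)
  then have "words ({} :: 'i set) x = {\<lambda>_. undefined}"
    by (auto simp: words_def)
  with x show ?case by simp
next
  case (insert a I)
  \<comment> \<open>The counts left for \<open>I\<close> once position \<open>a\<close> has taken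
    outcome \<open>l\<close>. The truncated subtraction is harmless, since \<open>l\<close> is used
    only when \<open>x l > 0\<close>.\<close>
  define y where "y l = x(l := x l - 1)" for l
  have sum_x: "(\<Sum>j\<in>UNIV. x j) = Suc (card I)"
    using insert by (simp add: multinomial_support_def)
  have y: "y l \<in> multinomial_support (card I)" if "x l > 0" for l
  proof -
    have "(\<Sum>j\<in>UNIV. y l j) = y l l + (\<Sum>j\<in>UNIV - {l}. y l j)"
      by (simp add: sum.remove[of _ l])
    also have "(\<Sum>j\<in>UNIV - {l}. y l j) = (\<Sum>j\<in>UNIV - {l}. x j)"
      by (intro sum.cong) (auto simp: y_def)
    also have "x l + \<dots> = (\<Sum>j\<in>UNIV. x j)"
      by (simp add: sum.remove[of _ l])
    ultimately show ?thesis using that sum_x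
      by (simp add: multinomial_support_def y_def)
  qed
  have cnt: "card {i \<in> insert a I. f i = l} = card {i \<in> I. f i = l} + (if f a = l then 1 else 0)" for f :: "'i \<Rightarrow> 'd" and l
  proof (cases "f a = l")
    case True
    then have "{i \<in> insert a I. f i = l} = insert a {i \<in> I. f i = l}" by auto
    then show ?thesis using insert True by simp
  next
    case False
    then have "{i \<in> insert a I. f i = l} = {i \<in> I. f i = l}" by auto
    then show ?thesis using False by simp
  qed
  have cong: "{i \<in> I. (f(a := b)) i = l} = {i \<in> I. f i = l}" for f :: "'i \<Rightarrow> 'd" and b l
    using insert by auto
  \<comment> \<open>A sequence on \<open>insert a I\<close> is its value at \<open>a\<close>
    together with its restriction to \<open>I\<close>; resetting \<open>a\<close> to
    \<open>undefined\<close> makes the restriction extensional again.\<close>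
  have "bij_betw (\<lambda>(l, f). f(a := l)) (SIGMA l:{l. x l > 0}. words I (y l)) (words (insert a I) x)"
  proof (rule bij_betw_byWitness[where f' = "\<lambda>f. (f a, f(a := undefined))"])
    show "\<forall>lf\<in>SIGMA l:{l. x l > 0}. words I (y l).
        (\<lambda>f. (f a, f(a := undefined))) ((\<lambda>(l, f). f(a := l)) lf) = lf"
      using insert by (auto simp: words_def PiE_def extensional_def)
    show "\<forall>f\<in>words (insert a I) x. (\<lambda>(l, f). f(a := l)) (f a, f(a := undefined)) = f"
      by auto
    show "(\<lambda>(l, f). f(a := l)) ` (SIGMA l:{l. x l > 0}. words I (y l)) \<subseteq> words (insert a I) x"
    proof clarsimp
      fix l f assume l: "x l > 0" and f: "f \<in> words I (y l)"
      then have "card {i \<in> I. f i = k} + (if l = k then 1 else 0) = x k" for k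
        by (auto simp: words_def y_def)
      then have "card {i \<in> insert a I. (f(a := l)) i = k} = x k" for k
        unfolding cnt cong by simp
      with f show "f(a := l) \<in> words (insert a I) x"
        by (simp add: words_def PiE_def extensional_def del: fun_upd_apply) simp
    qed
    show "(\<lambda>f. (f a, f(a := undefined))) ` words (insert a I) x \<subseteq> (SIGMA l:{l. x l > 0}. words I (y l))"
    proof (clarsimp, intro conjI)
      fix f assume f: "f \<in> words (insert a I) x"
      then have c: "card {i \<in> I. f i = l} + (if f a = l then 1 else 0) = x l" for l
        using cnt[of f l] by (auto simp: words_def)
      show "x (f a) > 0" using c[of "f a"] by simp
      show "f(a := undefined) \<in> words I (y (f a))"
        using c f by (auto simp: words_def cong y_def PiE_def extensional_def simp del: fun_upd_apply)
          (auto simp flip: c)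
    qed
  qed
  then have "card (words (insert a I) x) = card (SIGMA l:{l. x l > 0}. words I (y l))"
    by (metis bij_betw_same_card)
  also have "\<dots> = (\<Sum>l\<in>{l. x l > 0}. card (words I (y l)))"
    using insert by (intro card_SigmaI) (auto intro: finite_words)
  finally have "real (card (words (insert a I) x)) = (\<Sum>l\<in>{l. x l > 0}. real (card (words I (y l))))"
    by simp
  also have "\<dots> = (\<Sum>l\<in>{l. x l > 0}. fact (card I) * x l / (\<Prod>j\<in>UNIV. fact (x j)))"
  proof (intro sum.cong refl)
    fix l assume l: "l \<in> {l. x l > 0}"
    have "(\<Prod>j\<in>UNIV. fact (x j) :: real) = fact (x l) * (\<Prod>j\<in>UNIV - {l}. fact (x j))"
      by (simp add: prod.remove[of _ l])
    also have "(\<Prod>j\<in>UNIV - {l}. fact (x j) :: real) = (\<Prod>j\<in>UNIV - {l}. fact (y l j))"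
      by (intro prod.cong) (auto simp: y_def)
    also have "fact (x l) = x l * (fact (y l l) :: real)"
      using l by (simp add: y_def fact_reduce)
    also have "x l * (fact (y l l) :: real) * (\<Prod>j\<in>UNIV - {l}. fact (y l j)) = x l * (\<Prod>j\<in>UNIV. fact (y l j))"
      by (simp add: prod.remove[of _ l])
    finally show "real (card (words I (y l))) = fact (card I) * x l / (\<Prod>j\<in>UNIV. fact (x j))"
      using insert.IH[OF y[of l]] l by simp
  qed
  also have "\<dots> = fact (card I) * real (\<Sum>l\<in>{l. x l > 0}. x l) / (\<Prod>j\<in>UNIV. fact (x j))"
    by (simp add: sum_divide_distrib sum_distrib_left)
  \<comment> \<open>Outcomes that do not occur add nothing, so the total is
    \<open>Suc (card I)\<close>, the factor that raises \<open>fact (card I)\<close> to the next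
    factorial.\<close>
  also have "(\<Sum>l\<in>{l. x l > 0}. x l) = (\<Sum>l\<in>UNIV. x l)"
    by (intro sum.mono_neutral_left) auto
  finally show ?case using sum_x insert by (simp add: algebra_simps)
qed

text \<open>All sequences in \<open>words I x\<close> have the same product weight, so the
  multinomial law is the product law lumped by counts.\<close>

lemma multinomial_mass_words:
  fixes x :: "'d::finite \<Rightarrow> nat"
  assumes "finite I" "x \<in> multinomial_support (card I)"
  shows "multinomial_mass (card I) p x = (\<Sum>f\<in>words I x. \<Prod>i\<in>I. p (f i))"
  using assms by (simp add: multinomial_mass_def card_words prod_words)

subsection \<open>Krawtchouk polynomials as sums over index sequences\<close>

lemma orthonormal_system_complete:
  fixes p :: "'d::finite \<Rightarrow> real"
  assumes p: "\<And>k. p k > 0" and u: "orthonormal_system p u"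
  shows "(\<Sum>r<CARD('d). u r k * u r l) = (if k = l then 1 / p k else 0)"
proof -
  \<comment> \<open>The functions are numbered by naturals and their arguments range over
    \<open>'d\<close>. Relabelling the functions by \<open>'d\<close> gives a square matrix, for
    which a right inverse is also a left inverse.\<close>
  obtain e :: "'d \<Rightarrow> nat" where e: "bij_betw e UNIV {..<CARD('d)}"
    using ex_bij_betw_finite_nat[OF finite[of "UNIV::'d set"]] by (auto simp: atLeast0LessThan)
  have e_less: "e i < CARD('d)" for i using e by (auto simp: bij_betw_def)
  have e_inj: "e i = e j \<longleftrightarrow> i = j" for i j using e by (auto simp: bij_betw_def inj_on_def)
  \<comment> \<open>\<open>M\<close> has orthonormal rows, hence orthonormal columns.\<close>
  define M :: "real^'d^'d" where "M = (\<chi> i j. u (e i) j * sqrt (p j))"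
  have sq: "sqrt (p j) * (sqrt (p j) * a) = p j * a" for j a
    using p[of j] by (simp flip: mult.assoc)
  have "M ** transpose M = mat 1"
    using u e_less p unfolding orthonormal_system_def M_def
    by (auto simp: vec_eq_iff matrix_matrix_mult_def transpose_def mat_def e_inj sq mult_ac less_imp_le
          abs_of_pos)
  then have "transpose M ** M = mat 1"
    by (simp add: matrix_left_right_inverse)
  then have "(transpose M ** M) $ k $ l = (if k = l then 1 else 0)"
    by (simp add: mat_def)
  then have "(\<Sum>i\<in>UNIV. u (e i) k * u (e i) l) * (sqrt (p k) * sqrt (p l)) = (if k = l then 1 else 0)"
    by (simp add: matrix_matrix_mult_def transpose_def M_def sum_distrib_left mult_ac)
  also have "(\<Sum>i\<in>UNIV. u (e i) k * u (e i) l) = (\<Sum>r<CARD('d). u r k * u r l)"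
    by (rule sum.reindex_bij_betw[OF e])
  finally show ?thesis
    using p[of k] p[of l] by (auto simp: divide_simps mult_ac sq split: if_splits)
qed

text \<open>The index \<open>0\<close> stands for the constant term \<open>1\<close> of a factor of the generating polynomial.\<close>

definition exponent :: "nat \<Rightarrow> nat \<Rightarrow>\<^sub>0 nat" where
  "exponent r = (if r = 0 then 0 else Poly_Mapping.single r 1)"

text \<open>An index sequence picks one term from each factor of the generating polynomial; this set
  collects the picks whose monomials multiply to \<open>\<nu>\<close>.\<close>

definition index_words :: "'i set \<Rightarrow> nat \<Rightarrow> (nat \<Rightarrow>\<^sub>0 nat) \<Rightarrow> ('i \<Rightarrow> nat) set" where
  "index_words I d \<nu> = {g \<in> I \<rightarrow>\<^sub>E {..<d}. (\<Sum>i\<in>I. exponent (g i)) = \<nu>}"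

lemma finite_index_words: "finite I \<Longrightarrow> finite (index_words I d \<nu>)"
  by (rule finite_subset[of _ "I \<rightarrow>\<^sub>E {..<d}"]) (auto simp: index_words_def intro!: finite_PiE)

lemma prod_single:
  assumes "finite I"
  shows "(\<Prod>i\<in>I. Poly_Mapping.single (k i) (c i :: 'c::comm_semiring_1))
    = Poly_Mapping.single (\<Sum>i\<in>I. k i :: 'k::comm_monoid_add) (\<Prod>i\<in>I. c i)"
  using assms by (induction I rule: finite_induct) (auto simp: mult_single)

lemma lookup_exponent: "Poly_Mapping.lookup (exponent r) l = (if l = r \<and> r \<noteq> 0 then 1 else 0)"
  by (auto simp: exponent_def lookup_single when_def)

lemma lookup_sum_exponent:
  assumes "finite I" "l > 0"
  shows "Poly_Mapping.lookup (\<Sum>i\<in>I. exponent (g i)) l = card {i\<in>I. g i = l}"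
proof -
  have "Poly_Mapping.lookup (\<Sum>i\<in>I. exponent (g i)) l = (\<Sum>i\<in>I. if g i = l then 1 else 0)"
    unfolding lookup_sum using assms by (intro sum.cong) (auto simp: lookup_exponent)
  then show ?thesis using assms by (simp add: sum.If_cases Int_def)
qed

text \<open>Along any one sequence \<open>f\<close> with counts \<open>x\<close>, the generating
  polynomial is a product over positions, and expanding it means picking one term per position. In
  particular the right-hand side does not depend on the choice of \<open>f\<close>.\<close>

lemma multi_krawtchouk_words:
  fixes x :: "'d::finite \<Rightarrow> nat"
  assumes I: "finite I" and u: "\<And>j. u 0 j = 1" and f: "f \<in> words I x"
  shows "multi_krawtchouk u \<nu> x = (\<Sum>g\<in>index_words I CARD('d) \<nu>. \<Prod>i\<in>I. u (g i) (f i))"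
proof -
  have d: "{..<CARD('d)} = insert 0 {1..CARD('d) - 1}"
    using zero_less_card_finite[where 'a='d] by (auto simp del: zero_less_card_finite)
  have "krawtchouk_genpoly u x = (\<Prod>i\<in>I. 1 + (\<Sum>l\<in>{1..CARD('d) - 1}.
        Poly_Mapping.single (Poly_Mapping.single l 1) (u l (f i))))"
    unfolding krawtchouk_genpoly_def by (rule prod_words[OF I f, symmetric])
  also have "\<dots> = (\<Prod>i\<in>I. \<Sum>r<CARD('d). Poly_Mapping.single (exponent r) (u r (f i)))"
    unfolding d by (intro prod.cong) (auto simp: exponent_def u intro!: sum.cong)
  also have "\<dots> = (\<Sum>g\<in>I \<rightarrow>\<^sub>E {..<CARD('d)}. \<Prod>i\<in>I. Poly_Mapping.single (exponent (g i)) (u (g i) (f i)))"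
    using I by (rule prod_sum_PiE) simp
  also have "\<dots> = (\<Sum>g\<in>I \<rightarrow>\<^sub>E {..<CARD('d)}.
      Poly_Mapping.single (\<Sum>i\<in>I. exponent (g i)) (\<Prod>i\<in>I. u (g i) (f i)))"
    by (simp add: prod_single I)
  finally have "multi_krawtchouk u \<nu> x = (\<Sum>g\<in>I \<rightarrow>\<^sub>E {..<CARD('d)}.
      if (\<Sum>i\<in>I. exponent (g i)) = \<nu> then \<Prod>i\<in>I. u (g i) (f i) else 0)"
    by (simp add: multi_krawtchouk_def lookup_sum lookup_single when_def)
  also have "\<dots> = (\<Sum>g\<in>index_words I CARD('d) \<nu>. \<Prod>i\<in>I. u (g i) (f i))"
    unfolding index_words_def using I by (intro sum.inter_filter[symmetric] finite_PiE) auto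
  finally show ?thesis .
qed

text \<open>The square expands into pairs \<open>g\<close>, \<open>h\<close> of index sequences.
  Under the product law the sum over outcomes factorizes over positions, and orthonormality leaves 1
  for \<open>g = h\<close> and 0 otherwise, so the squared norm counts index sequences.\<close>

lemma multi_krawtchouk_norm:
  fixes p :: "'d::finite \<Rightarrow> real"
  assumes I: "finite I" and u: "orthonormal_system p u"
  shows "(\<Sum>x\<in>multinomial_support (card I). multinomial_mass (card I) p x * (multi_krawtchouk u \<nu> x)\<^sup>2)
    = card (index_words I CARD('d) \<nu>)"
proof -
  let ?G = "index_words I CARD('d) \<nu>"
  have u0: "u 0 j = 1" for j using u by (simp add: orthonormal_system_def)
  have "(\<Sum>x\<in>multinomial_support (card I). multinomial_mass (card I) p x * (multi_krawtchouk u \<nu> x)\<^sup>2)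
    = (\<Sum>x\<in>multinomial_support (card I). \<Sum>f\<in>words I x.
        (\<Prod>i\<in>I. p (f i)) * (\<Sum>g\<in>?G. \<Prod>i\<in>I. u (g i) (f i))\<^sup>2)"
    using I by (intro sum.cong refl)
      (simp add: multinomial_mass_words sum_distrib_right multi_krawtchouk_words[where u = u, OF I u0])
  also have "\<dots> = (\<Sum>f\<in>I \<rightarrow>\<^sub>E UNIV. (\<Prod>i\<in>I. p (f i)) * (\<Sum>g\<in>?G. \<Prod>i\<in>I. u (g i) (f i))\<^sup>2)"
    by (rule sum_words[OF I, symmetric])
  also have "\<dots> = (\<Sum>f\<in>I \<rightarrow>\<^sub>E UNIV. \<Sum>g\<in>?G. \<Sum>h\<in>?G. \<Prod>i\<in>I. u (g i) (f i) * u (h i) (f i) * p (f i))"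
    by (simp add: power2_eq_square sum_product sum_distrib_left prod.distrib mult_ac)
  also have "\<dots> = (\<Sum>g\<in>?G. \<Sum>h\<in>?G. \<Sum>f\<in>I \<rightarrow>\<^sub>E UNIV. \<Prod>i\<in>I. u (g i) (f i) * u (h i) (f i) * p (f i))"
    by (subst sum.swap, intro sum.cong refl, rule sum.swap)
  also have "\<dots> = (\<Sum>g\<in>?G. \<Sum>h\<in>?G. \<Prod>i\<in>I. \<Sum>j\<in>UNIV. u (g i) j * u (h i) j * p j)"
    by (simp add: prod_sum_PiE I)
  also have "\<dots> = (\<Sum>g\<in>?G. \<Sum>h\<in>?G. if g = h then 1 else 0)"
  proof (intro sum.cong refl)
    fix g h assume gh: "g \<in> ?G" "h \<in> ?G"
    have "(\<Prod>i\<in>I. \<Sum>j\<in>UNIV. u (g i) j * u (h i) j * p j) = (\<Prod>i\<in>I. if g i = h i then 1 else 0)"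
      using gh u by (intro prod.cong) (auto simp: index_words_def orthonormal_system_def PiE_iff)
    also have "\<dots> = (if \<forall>i\<in>I. g i = h i then 1 else 0)"
      using I by (auto intro: prod.neutral)
    also have "(\<forall>i\<in>I. g i = h i) \<longleftrightarrow> g = h"
      using gh by (auto simp: index_words_def intro: PiE_ext)
    finally show "(\<Prod>i\<in>I. \<Sum>j\<in>UNIV. u (g i) j * u (h i) j * p j) = (if g = h then 1 else 0)" .
  qed
  also have "\<dots> = card ?G"
    using I by (simp add: finite_index_words)
  finally show ?thesis .
qed

section \<open>Symmetry under permutations of the positions\<close>

lemma words_permute:
  assumes "\<pi> permutes I" "f \<in> words I x" shows "f \<circ> \<pi> \<in> words I x"
proof -
  have "card {i \<in> I. f (\<pi> i) = l} = card {i \<in> I. f i = l}" for l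
  proof (rule bij_betw_same_card[of \<pi>])
    show "bij_betw \<pi> {i \<in> I. f (\<pi> i) = l} {i \<in> I. f i = l}"
      using assms(1) by (intro bij_betw_byWitness[of _ "inv \<pi>"])
        (auto simp: permutes_inverses permutes_in_image permutes_inv)
  qed
  with assms show ?thesis
    by (auto simp: words_def PiE_def extensional_def permutes_not_in)
qed

text \<open>The exponent records how often each positive index occurs, and zeros fill the remaining
  positions. Equal exponents thus give equal multisets of values, hence a rearrangement of
  \<open>I\<close>.\<close>

lemma index_words_permute:
  assumes I: "finite I" and g: "g \<in> index_words I d \<nu>" and h: "h \<in> index_words I d \<nu>"
  obtains \<pi> where "\<pi> permutes I" "\<forall>i\<in>I. g i = h (\<pi> i)"
proof -
  have pos: "card {i\<in>I. g i = r} = card {i\<in>I. h i = r}" if "r > 0" for r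
    using g h lookup_sum_exponent[OF I that, of g] lookup_sum_exponent[OF I that, of h]
    by (simp add: index_words_def)
  \<comment> \<open>Index 0 leaves no trace in the exponent, so its multiplicity is recovered by
    complement.\<close>
  have total: "card {i\<in>I. f i = 0} + (\<Sum>r\<in>{1..<d}. card {i\<in>I. f i = r}) = card I"
    if "f \<in> index_words I d \<nu>" "d > 0" for f :: "'a \<Rightarrow> nat"
  proof -
    have "(\<Sum>r\<in>{..<d}. card {i\<in>I. f i = r}) = card I"
      using sum.group[of I "{..<d}" f "\<lambda>_. 1::nat"] I that by (auto simp: index_words_def PiE_iff)
    moreover have "{..<d} = insert 0 {1..<d}" using that by auto
    ultimately show ?thesis by simp
  qed
  have "card {i\<in>I. g i = r} = card {i\<in>I. h i = r}" for r
  proof (cases "r = 0")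
    case True
    show ?thesis
    proof (cases "d = 0")
      case True
      then have "I = {}" using g by (auto simp: index_words_def PiE_iff)
      then show ?thesis by simp
    next
      case False
      moreover have "(\<Sum>r\<in>{1..<d}. card {i\<in>I. g i = r}) = (\<Sum>r\<in>{1..<d}. card {i\<in>I. h i = r})"
        by (intro sum.cong) (auto simp: pos)
      ultimately show ?thesis using total[OF g] total[OF h] \<open>r = 0\<close> by simp
    qed
  qed (simp add: pos)
  moreover have "{i\<in>I. r = f i} = {i\<in>I. f i = r}" for f :: "'a \<Rightarrow> nat" and r by auto
  ultimately have "image_mset g (mset_set I) = image_mset h (mset_set I)"
    using I by (auto intro!: multiset_eqI simp: count_image_mset' sum.If_cases Int_def)
  from image_mset_eq_implies_permutes[OF I this] that show ?thesis by blast
qed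

text \<open>Rearranging positions maps \<open>words I x\<close> onto itself, so the permutation that
  relates \<open>g\<close> to \<open>h\<close> is absorbed by the summation over
  \<open>f\<close>.\<close>

lemma sum_words_index_words_cong:
  fixes u :: "nat \<Rightarrow> 'd \<Rightarrow> real"
  assumes I: "finite I" and g: "g \<in> index_words I d \<nu>" and h: "h \<in> index_words I d \<nu>"
  shows "(\<Sum>f\<in>words I x. \<Prod>i\<in>I. u (g i) (f i)) = (\<Sum>f\<in>words I x. \<Prod>i\<in>I. u (h i) (f i))"
proof -
  obtain \<pi> where \<pi>: "\<pi> permutes I" "\<forall>i\<in>I. g i = h (\<pi> i)"
    using index_words_permute[OF I g h] by blast
  have "(\<Sum>f\<in>words I x. \<Prod>i\<in>I. u (h i) (f i)) = (\<Sum>f\<in>words I x. \<Prod>i\<in>I. u (g i) ((f \<circ> \<pi>) i))"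
    using \<pi> by (intro sum.cong refl, subst prod.permute[OF \<pi>(1)]) (auto intro!: prod.cong)
  also have "\<dots> = (\<Sum>f\<in>words I x. \<Prod>i\<in>I. u (g i) (f i))"
    by (rule sum.reindex_bij_witness[of _ "\<lambda>f. f \<circ> inv \<pi>" "\<lambda>f. f \<circ> \<pi>"])
      (use \<pi>(1) in \<open>auto simp: o_def permutes_inverses dest: words_permute[OF \<pi>(1)]
         words_permute[OF permutes_inv[OF \<pi>(1)]]\<close>)
  finally show ?thesis ..
qed

text \<open>The sum over \<open>f\<close> is the same for every index sequence of type
  \<open>\<nu>\<close>, so it equals its average over the type. After the sums are exchanged, each
  inner sum is \<open>multi_krawtchouk u \<nu> x\<close>, whatever \<open>f\<close> is.\<close>

lemma sum_words_character:
  fixes x :: "'d::finite \<Rightarrow> nat"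
  assumes I: "finite I" and u: "\<And>j. u 0 j = 1" and g: "g \<in> index_words I CARD('d) \<nu>"
  shows "(\<Sum>f\<in>words I x. \<Prod>i\<in>I. u (g i) (f i) :: real)
    = real (card (words I x)) * multi_krawtchouk u \<nu> x / real (card (index_words I CARD('d) \<nu>))"
proof -
  let ?G = "index_words I CARD('d) \<nu>"
  have "real (card ?G) * (\<Sum>f\<in>words I x. \<Prod>i\<in>I. u (g i) (f i))
    = (\<Sum>h\<in>?G. \<Sum>f\<in>words I x. \<Prod>i\<in>I. u (g i) (f i))"
    by simp
  also have "\<dots> = (\<Sum>h\<in>?G. \<Sum>f\<in>words I x. \<Prod>i\<in>I. u (h i) (f i))"
    by (intro sum.cong refl sum_words_index_words_cong[OF I g])
  also have "\<dots> = (\<Sum>f\<in>words I x. multi_krawtchouk u \<nu> x)"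
    by (subst sum.swap) (simp add: multi_krawtchouk_words[where u = u, OF I u])
  also have "\<dots> = real (card (words I x)) * multi_krawtchouk u \<nu> x"
    by simp
  finally have "real (card ?G) * (\<Sum>f\<in>words I x. \<Prod>i\<in>I. u (g i) (f i))
    = real (card (words I x)) * multi_krawtchouk u \<nu> x" .
  moreover have "card ?G \<noteq> 0" using g finite_index_words[OF I] by auto
  ultimately show ?thesis by (simp add: field_simps)
qed

section \<open>Grouping of index sequences by degree and type\<close>

lemma finite_multi_degrees: "finite (multi_degrees d n)"
proof -
  have "finite (Poly_Mapping.lookup ` multi_degrees d n)"
  proof (rule finite_subset)
    show "Poly_Mapping.lookup ` multi_degrees d n \<subseteq>
        {f. \<forall>l. (l \<in> {1..d - 1} \<longrightarrow> f l \<in> {..n}) \<and> (l \<notin> {1..d - 1} \<longrightarrow> f l = 0)}"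
      by (auto simp: multi_degrees_def in_keys_iff subset_iff intro!: member_le_sum)
  qed (intro finite_set_of_finite_funs; simp)
  then show ?thesis
    by (rule finite_imageD) (auto intro: inj_onI simp: poly_mapping_eqI)
qed

text \<open>Each nonzero index contributes one indeterminate and each zero contributes none.\<close>

lemma sum_exponent_in_multi_degrees:
  assumes I: "finite I" and g: "g \<in> I \<rightarrow>\<^sub>E {..<d}"
  shows "(\<Sum>i\<in>I. exponent (g i)) \<in> multi_degrees d (card {i\<in>I. g i \<noteq> 0})"
proof -
  have "(\<Sum>l\<in>{1..d - 1}. card {i\<in>I. g i = l}) = (\<Sum>l\<in>{1..d - 1}. card {i\<in>{i\<in>I. g i \<noteq> 0}. g i = l})"
    by (intro sum.cong arg_cong[where f = card]) auto
  also have "\<dots> = card {i\<in>I. g i \<noteq> 0}"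
    using sum.group[of "{i\<in>I. g i \<noteq> 0}" "{1..d - 1}" g "\<lambda>_. 1::nat"] I g
    by (fastforce simp: PiE_iff)
  finally have "(\<Sum>l\<in>{1..d - 1}. Poly_Mapping.lookup (\<Sum>i\<in>I. exponent (g i)) l) = card {i\<in>I. g i \<noteq> 0}"
    using lookup_sum_exponent[OF I] by simp
  moreover have "l \<in> {1..d - 1}" if "Poly_Mapping.lookup (\<Sum>i\<in>I. exponent (g i)) l \<noteq> 0" for l
  proof -
    from that obtain i where "i \<in> I" "Poly_Mapping.lookup (exponent (g i)) l \<noteq> 0"
      unfolding lookup_sum by (meson sum.not_neutral_contains_not_neutral)
    with g show ?thesis by (auto simp: lookup_exponent PiE_iff split: if_splits)
  qed
  ultimately show ?thesis
    by (auto simp: multi_degrees_def in_keys_iff simp del: lookup_sum)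
qed

lemma sum_index_words:
  fixes F :: "('i \<Rightarrow> nat) \<Rightarrow> real"
  assumes I: "finite I"
  shows "(\<Sum>g\<in>I \<rightarrow>\<^sub>E {..<d}. F g) = (\<Sum>n\<le>card I. \<Sum>\<nu>\<in>multi_degrees d n. \<Sum>g\<in>index_words I d \<nu>. F g)"
proof -
  let ?P = "I \<rightarrow>\<^sub>E {..<d}" and ?e = "\<lambda>g. \<Sum>i\<in>I. exponent (g i)"
  have fin: "finite ?P" using I by (intro finite_PiE) auto
  have "(\<Sum>g\<in>?P. F g) = (\<Sum>n\<le>card I. \<Sum>g\<in>{g\<in>?P. card {i\<in>I. g i \<noteq> 0} = n}. F g)"
    using I fin by (intro sum.group[symmetric]) (auto intro!: card_mono)
  also have "\<dots> = (\<Sum>n\<le>card I. \<Sum>\<nu>\<in>multi_degrees d n. \<Sum>g\<in>{g\<in>{g\<in>?P. card {i\<in>I. g i \<noteq> 0} = n}. ?e g = \<nu>}. F g)"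
    using I fin sum_exponent_in_multi_degrees[OF I]
    by (intro sum.cong refl sum.group[symmetric] finite_multi_degrees) auto
  \<comment> \<open>The exponent already determines the number of nonzero indices, so within one
    type the degree condition holds automatically.\<close>
  also have "{g\<in>{g\<in>?P. card {i\<in>I. g i \<noteq> 0} = n}. ?e g = \<nu>} = index_words I d \<nu>"
    if "\<nu> \<in> multi_degrees d n" for n \<nu>
    using that sum_exponent_in_multi_degrees[OF I] unfolding index_words_def multi_degrees_def
    by fastforce
  then have "(\<Sum>n\<le>card I. \<Sum>\<nu>\<in>multi_degrees d n. \<Sum>g\<in>{g\<in>{g\<in>?P. card {i\<in>I. g i \<noteq> 0} = n}. ?e g = \<nu>}. F g)
     = (\<Sum>n\<le>card I. \<Sum>\<nu>\<in>multi_degrees d n. \<Sum>g\<in>index_words I d \<nu>. F g)"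
    by (intro sum.cong) auto
  finally show ?thesis .
qed

lemma card_nonzero_index_words:
  assumes I: "finite I" and g: "g \<in> index_words I d \<nu>" and "\<nu> \<in> multi_degrees d n"
  shows "card {i\<in>I. g i \<noteq> 0} = n"
  using sum_exponent_in_multi_degrees[OF I, of g d] assms by (auto simp: index_words_def multi_degrees_def)

section \<open>Kernel expansion of the sum over pairs of sequences\<close>

lemma sum_words_matching:
  fixes p :: "'d::finite \<Rightarrow> real" and t :: real
  assumes I: "finite I" and p: "\<And>k. p k > 0" and u: "orthonormal_system p u"
  shows "(\<Sum>f\<in>words I x. \<Sum>g\<in>words I y. \<Prod>i\<in>I. 1 + t * (if f i = g i then 1 / p (f i) else 0))
    = real (card (words I x)) * real (card (words I y)) *
      (\<Sum>n\<le>card I. (1 + t) ^ (card I - n) * t ^ n * kernel_polynomial (card I) p u n x y)"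
proof -
  let ?d = "CARD('d)"
  \<comment> \<open>By completeness the matching term is \<open>t\<close> times a sum over all
    \<open>r\<close>; the leading 1 merges with \<open>r = 0\<close>, because \<open>u 0\<close> is
    constantly 1.\<close>
  define c where "c r = (if r = 0 then 1 + t else t)" for r :: nat
  define S where "S x h = (\<Sum>f\<in>words I x. \<Prod>i\<in>I. u (h i) (f i))" for x :: "'d \<Rightarrow> nat" and h
  have u0: "u 0 j = 1" for j using u by (simp add: orthonormal_system_def)
  have d: "{..<?d} = insert 0 {1..<?d}"
    using zero_less_card_finite[where 'a='d] by (auto simp del: zero_less_card_finite)
  have factor: "1 + t * (if k = l then 1 / p k else 0) = (\<Sum>r<?d. c r * (u r k * u r l))" for k l
    unfolding orthonormal_system_complete[OF p u, symmetric] d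
    by (simp add: c_def u0 algebra_simps sum_distrib_left)
  have "(\<Sum>f\<in>words I x. \<Sum>g\<in>words I y. \<Prod>i\<in>I. 1 + t * (if f i = g i then 1 / p (f i) else 0))
    = (\<Sum>f\<in>words I x. \<Sum>g\<in>words I y. \<Sum>h\<in>I \<rightarrow>\<^sub>E {..<?d}.
        (\<Prod>i\<in>I. c (h i)) * ((\<Prod>i\<in>I. u (h i) (f i)) * (\<Prod>i\<in>I. u (h i) (g i))))"
    unfolding factor using I by (simp add: prod_sum_PiE prod.distrib)
  also have "\<dots> = (\<Sum>h\<in>I \<rightarrow>\<^sub>E {..<?d}. \<Sum>f\<in>words I x. \<Sum>g\<in>words I y.
        (\<Prod>i\<in>I. c (h i)) * ((\<Prod>i\<in>I. u (h i) (f i)) * (\<Prod>i\<in>I. u (h i) (g i))))"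
    (is "?A = ?B")
  proof -
    have "?B = (\<Sum>f\<in>words I x. \<Sum>h\<in>I \<rightarrow>\<^sub>E {..<?d}. \<Sum>g\<in>words I y.
        (\<Prod>i\<in>I. c (h i)) * ((\<Prod>i\<in>I. u (h i) (f i)) * (\<Prod>i\<in>I. u (h i) (g i))))"
      by (rule sum.swap)
    also have "\<dots> = ?A" by (intro sum.cong refl sum.swap)
    finally show ?thesis ..
  qed
  also have "\<dots> = (\<Sum>h\<in>I \<rightarrow>\<^sub>E {..<?d}. (\<Prod>i\<in>I. c (h i)) * (S x h * S y h))"
    unfolding S_def sum_product by (simp add: sum_distrib_left)
  also have "\<dots> = (\<Sum>n\<le>card I. \<Sum>\<nu>\<in>multi_degrees ?d n. \<Sum>h\<in>index_words I ?d \<nu>.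
      (\<Prod>i\<in>I. c (h i)) * (S x h * S y h))"
    by (rule sum_index_words[OF I])
  also have "\<dots> = (\<Sum>n\<le>card I. \<Sum>\<nu>\<in>multi_degrees ?d n.
      real (card (words I x)) * real (card (words I y)) * ((1 + t) ^ (card I - n) * t ^ n *
      (multi_krawtchouk_normalized (card I) p u \<nu> x * multi_krawtchouk_normalized (card I) p u \<nu> y)))"
  proof (intro sum.cong refl)
    fix n \<nu> assume \<nu>: "\<nu> \<in> multi_degrees ?d n"
    let ?G = "index_words I ?d \<nu>" and ?Cx = "real (card (words I x))" and ?Cy = "real (card (words I y))"
    have c: "(\<Prod>i\<in>I. c (h i)) = (1 + t) ^ (card I - n) * t ^ n" if "h \<in> ?G" for h
    proof -
      have "(\<Prod>i\<in>I. c (h i)) = (1 + t) ^ card {i\<in>I. h i = 0} * t ^ card {i\<in>I. h i \<noteq> 0}"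
        using I by (simp add: c_def prod.If_cases Int_def)
      moreover have "card I = card {i\<in>I. h i = 0} + card {i\<in>I. h i \<noteq> 0}"
        using I by (subst card_Un_disjoint[symmetric]) (auto intro: arg_cong[where f = card])
      ultimately show ?thesis using card_nonzero_index_words[OF I that \<nu>] by simp
    qed
    \<comment> \<open>On \<open>?G\<close> the weight and both sums over words are constant in
      \<open>h\<close>.\<close>
    have "(\<Sum>h\<in>?G. (\<Prod>i\<in>I. c (h i)) * (S x h * S y h))
      = (\<Sum>h\<in>?G. ((1 + t) ^ (card I - n) * t ^ n) *
          ((?Cx * multi_krawtchouk u \<nu> x / card ?G) * (?Cy * multi_krawtchouk u \<nu> y / card ?G)))"
      by (intro sum.cong refl) (simp only: c S_def sum_words_character[where u = u, OF I u0])
    \<comment> \<open>The \<open>card ?G\<close> equal summands cancel one of the two denominators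
      that came from averaging. The other is the squared norm, which the two normalizations share as
      square roots.\<close>
    also have "\<dots> = ?Cx * ?Cy * ((1 + t) ^ (card I - n) * t ^ n *
          (multi_krawtchouk u \<nu> x * multi_krawtchouk u \<nu> y / card ?G))"
      by (simp add: field_simps)
    also have "multi_krawtchouk u \<nu> x * multi_krawtchouk u \<nu> y / card ?G =
        multi_krawtchouk_normalized (card I) p u \<nu> x * multi_krawtchouk_normalized (card I) p u \<nu> y"
      by (simp add: multi_krawtchouk_normalized_def multi_krawtchouk_norm[OF I u])
    finally show "(\<Sum>h\<in>?G. (\<Prod>i\<in>I. c (h i)) * (S x h * S y h)) = ?Cx * ?Cy * ((1 + t) ^ (card I - n) * t ^ n *
      (multi_krawtchouk_normalized (card I) p u \<nu> x * multi_krawtchouk_normalized (card I) p u \<nu> y))" .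
  qed
  finally show ?thesis
    by (simp add: kernel_polynomial_def sum_distrib_left mult_ac)
qed

section \<open>Generating function of the mass function \<open>phi\<close>\<close>

text \<open>Once \<open>krawtchouk n N p z\<close> is replaced by a coefficient of its generating
  polynomial in \<open>w\<close>, the sum over \<open>z\<close> is a binomial expansion and
  collapses to the \<open>N\<close>-th power of a linear polynomial, whose coefficient of
  \<open>w^n\<close> is read off.\<close>

lemma krawtchouk_transform:
  fixes p s :: real
  assumes p: "p \<noteq> 0" and n: "n \<le> N"
  shows "(\<Sum>z\<le>N. real (N choose z) * p ^ z * (1 - p) ^ (N - z) * krawtchouk n N p z * s ^ (N - z))
    = (1 + (1 - p) * (s - 1)) ^ (N - n) * ((1 - p) * (s - 1)) ^ n"
proof -
  let ?q = "1 - p"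
  \<comment> \<open>The generating polynomial \<open>\<Sum>\<^sub>n (N choose n) Q\<^sub>n(z) w\<^sup>n\<close> of the Krawtchouk polynomials.\<close>
  define K where "K z = [:1, - (?q / p):] ^ z * [:1, 1:] ^ (N - z)" for z
  have of_nat_smult: "of_nat m * P = smult (real m) P" for m and P :: "real poly"
    by (simp add: of_nat_poly)
  have coeff_pow: "poly.coeff ([:1, b:] ^ m) i = real (m choose i) * b ^ i" for b :: real and m i
  proof (cases "i \<le> m")
    case False
    then have "poly.coeff ([:1, b:] ^ m) i = 0"
      by (intro coeff_eq_0 le_less_trans[OF degree_power_le]) auto
    with False show ?thesis by simp
  qed (simp add: coeff_linear_poly_power)
  have K: "poly.coeff (K z) n = real (N choose n) * krawtchouk n N p z" for z
    using n unfolding K_def coeff_mult coeff_pow krawtchouk_def by (simp add: mult_ac)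
  \<comment> \<open>The two bases are \<open>p - ?q w\<close> and \<open>?q s (1 + w)\<close>; their
    sum is \<open>1 + ?q (s - 1) + ?q (s - 1) w\<close>, since \<open>p + ?q = 1\<close>.\<close>
  have "(\<Sum>z\<le>N. of_nat (N choose z) * (smult p [:1, - (?q / p):]) ^ z * (smult (?q * s) [:1, 1:]) ^ (N - z))
    = (smult p [:1, - (?q / p):] + smult (?q * s) [:1, 1:]) ^ N"
    by (rule binomial_ring[symmetric])
  also have "smult p [:1, - (?q / p):] + smult (?q * s) [:1, 1:] = [:1 + ?q * (s - 1), ?q * (s - 1):]"
    using p by (simp add: field_simps)
  also have "(\<Sum>z\<le>N. of_nat (N choose z) * (smult p [:1, - (?q / p):]) ^ z * (smult (?q * s) [:1, 1:]) ^ (N - z))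
    = (\<Sum>z\<le>N. smult (real (N choose z) * p ^ z * (?q * s) ^ (N - z)) (K z))"
    by (intro sum.cong refl)
      (simp only: K_def smult_power of_nat_smult mult_smult_left mult_smult_right smult_smult mult_ac)
  finally have "(\<Sum>z\<le>N. smult (real (N choose z) * p ^ z * (?q * s) ^ (N - z)) (K z))
    = [:1 + ?q * (s - 1), ?q * (s - 1):] ^ N" .
  then have "poly.coeff (\<Sum>z\<le>N. smult (real (N choose z) * p ^ z * (?q * s) ^ (N - z)) (K z)) n
    = poly.coeff ([:1 + ?q * (s - 1), ?q * (s - 1):] ^ N) n" by simp
  then have "(\<Sum>z\<le>N. real (N choose z) * p ^ z * (?q * s) ^ (N - z) * (real (N choose n) * krawtchouk n N p z))
    = real (N choose n) * (?q * (s - 1)) ^ n * (1 + ?q * (s - 1)) ^ (N - n)"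
    by (simp add: coeff_sum K coeff_linear_poly_power n)
  then have "real (N choose n) * (\<Sum>z\<le>N. real (N choose z) * p ^ z * ?q ^ (N - z) * krawtchouk n N p z * s ^ (N - z))
    = real (N choose n) * ((1 + ?q * (s - 1)) ^ (N - n) * (?q * (s - 1)) ^ n)"
    by (simp add: sum_distrib_left power_mult_distrib mult_ac)
  then show ?thesis using n by simp
qed

lemma phi_generating_function:
  fixes p :: "'d::finite \<Rightarrow> real"
  assumes q: "q < 1"
  shows "(\<Sum>k\<le>N. phi N p u q x y (N - k) * s ^ k)
    = (\<Sum>n\<le>N. (1 + q * (s - 1)) ^ (N - n) * (q * (s - 1)) ^ n * kernel_polynomial N p u n x y)"
proof -
  have "(\<Sum>k\<le>N. phi N p u q x y (N - k) * s ^ k) = (\<Sum>z\<le>N. phi N p u q x y z * s ^ (N - z))"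
    by (rule sum.reindex_bij_witness[of _ "\<lambda>z. N - z" "\<lambda>z. N - z"]) auto
  \<comment> \<open>The success probability is \<open>1 - q\<close>, so \<open>q\<close> is written
    as \<open>1 - (1 - q)\<close> to fit the transform.\<close>
  also have "\<dots> = (\<Sum>n\<le>N. (\<Sum>z\<le>N. real (N choose z) * (1 - q) ^ z * (1 - (1 - q)) ^ (N - z)
      * krawtchouk n N (1 - q) z * s ^ (N - z)) * kernel_polynomial N p u n x y)"
    unfolding phi_def sum_distrib_left sum_distrib_right
    by (subst sum.swap) (simp add: mult_ac)
  also have "\<dots> = (\<Sum>n\<le>N. (1 + q * (s - 1)) ^ (N - n) * (q * (s - 1)) ^ n * kernel_polynomial N p u n x y)"
    using q by (intro sum.cong refl) (subst krawtchouk_transform, auto)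
  finally show ?thesis .
qed

subsection \<open>Generating function of the number of thinned matches\<close>

lemma (in prob_space) expectation_bounded_nat:
  fixes h :: "nat \<Rightarrow> real"
  assumes V[measurable]: "V \<in> measurable M (count_space UNIV)"
    and le: "\<And>\<omega>. \<omega> \<in> space M \<Longrightarrow> V \<omega> \<le> N"
  shows "expectation (\<lambda>\<omega>. h (V \<omega>)) = (\<Sum>k\<le>N. h k * prob {\<omega>\<in>space M. V \<omega> = k})"
proof -
  have [simp]: "integrable M (indicat_real {\<omega>\<in>space M. V \<omega> = k})" for k
    by (intro integrable_real_indicator) (auto simp: emeasure_eq_measure)
  have "expectation (\<lambda>\<omega>. h (V \<omega>)) = expectation (\<lambda>\<omega>. \<Sum>k\<le>N. h k * indicator {\<omega>\<in>space M. V \<omega> = k} \<omega>)"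
  proof (rule Bochner_Integration.integral_cong[OF refl])
    fix \<omega> assume \<omega>: "\<omega> \<in> space M"
    have "(\<Sum>k\<le>N. h k * indicator {\<omega>\<in>space M. V \<omega> = k} \<omega>) = (\<Sum>k\<le>N. if k = V \<omega> then h k else 0)"
      using \<omega> by (intro sum.cong) auto
    then show "h (V \<omega>) = (\<Sum>k\<le>N. h k * indicator {\<omega>\<in>space M. V \<omega> = k} \<omega>)"
      using le[OF \<omega>] by simp
  qed
  also have "\<dots> = (\<Sum>k\<le>N. h k * prob {\<omega>\<in>space M. V \<omega> = k})"
    by (subst Bochner_Integration.integral_sum) (simp_all del: sum_mult_indicator add: Int_absorb2 subset_eq)
  finally show ?thesis .
qed

text \<open>The power \<open>s ^ card\<close> is a product of independent factors equal to
  \<open>s\<close> on success and 1 on failure, so its expectation factorizes. The sum may run to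
  any \<open>N\<close> above \<open>card J\<close>, as the extra probabilities vanish.\<close>

lemma (in prob_space) card_indep_generating_function:
  fixes B :: "'i \<Rightarrow> 'a \<Rightarrow> bool" and s :: real
  assumes J: "finite J" "card J \<le> N" and B: "indep_vars (\<lambda>_. count_space UNIV) B J"
  shows "(\<Sum>k\<le>N. s ^ k * \<P>(\<omega> in M. card {i\<in>J. B i \<omega>} = k)) = (\<Prod>i\<in>J. 1 + (s - 1) * \<P>(\<omega> in M. B i \<omega>))"
proof -
  have [measurable]: "B i \<in> measurable M (count_space UNIV)" if "i \<in> J" for i
    using B that by (auto simp: indep_vars_def)
  have card_eq: "card {i\<in>J. B i \<omega>} = (\<Sum>i\<in>J. if B i \<omega> then 1 else 0)" for \<omega>
    using J by (simp add: sum.If_cases Int_def)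
  have [measurable]: "(\<lambda>\<omega>. card {i\<in>J. B i \<omega>}) \<in> measurable M (count_space UNIV)"
    unfolding card_eq by measurable
  have factor: "expectation (\<lambda>\<omega>. if B i \<omega> then s else 1) = 1 + (s - 1) * \<P>(\<omega> in M. B i \<omega>)" if "i \<in> J" for i
  proof -
    note [measurable] = \<open>i \<in> J\<close>
    have [simp]: "integrable M (indicat_real {\<omega>\<in>space M. B i \<omega>})"
      by (intro integrable_real_indicator) (auto simp: emeasure_eq_measure)
    have "expectation (\<lambda>\<omega>. if B i \<omega> then s else 1) = expectation (\<lambda>\<omega>. 1 + (s - 1) * indicator {\<omega>\<in>space M. B i \<omega>} \<omega>)"
      by (intro Bochner_Integration.integral_cong) (auto simp: indicator_def)
    also have "\<dots> = 1 + (s - 1) * \<P>(\<omega> in M. B i \<omega>)"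
      by (subst Bochner_Integration.integral_add) (simp_all add: prob_space Int_absorb2 subset_eq)
    finally show ?thesis .
  qed
  have "(\<Sum>k\<le>N. s ^ k * \<P>(\<omega> in M. card {i\<in>J. B i \<omega>} = k)) = expectation (\<lambda>\<omega>. s ^ card {i\<in>J. B i \<omega>})"
  proof (rule expectation_bounded_nat[symmetric])
    show "card {i\<in>J. B i \<omega>} \<le> N" for \<omega>
      using card_mono[OF J(1), of "{i\<in>J. B i \<omega>}"] J(2) by auto
  qed measurable
  also have "\<dots> = expectation (\<lambda>\<omega>. \<Prod>i\<in>J. if B i \<omega> then s else 1)"
    using J by (simp add: prod.If_cases Int_def)
  also have "\<dots> = (\<Prod>i\<in>J. expectation (\<lambda>\<omega>. if B i \<omega> then s else 1))"
  proof (rule indep_vars_lebesgue_integral[OF J(1)])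
    show "indep_vars (\<lambda>_. borel) (\<lambda>i \<omega>. if B i \<omega> then s else 1) J"
      by (rule indep_vars_compose2[OF B]) simp
    show "integrable M (\<lambda>\<omega>. if B i \<omega> then s else 1)" if "i \<in> J" for i
    proof (rule integrable_const_bound[of _ "max \<bar>s\<bar> 1"])
      note [measurable] = that
      show "(\<lambda>\<omega>. if B i \<omega> then s else 1) \<in> borel_measurable M" by measurable
    qed auto
  qed
  finally show ?thesis by (simp add: factor)
qed

section \<open>Joint law of the two sequences and the coins\<close>

lemma independent_elements_prob:
  assumes M: "prob_space M" and ind: "independent_elements M S X T Y"
    and sets: "P \<in> sets S" "Q \<in> sets T"
  shows "\<P>(\<omega> in M. X \<omega> \<in> P \<and> Y \<omega> \<in> Q) = \<P>(\<omega> in M. X \<omega> \<in> P) * \<P>(\<omega> in M. Y \<omega> \<in> Q)"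
proof -
  interpret prob_space M by (rule M)
  have "prob ((X -` P \<inter> space M) \<inter> (Y -` Q \<inter> space M)) = prob (X -` P \<inter> space M) * prob (Y -` Q \<inter> space M)"
    using ind sets unfolding independent_elements_def
    by (intro indep_setD[of "sets (vimage_algebra (space M) X S)" "sets (vimage_algebra (space M) Y T)"])
       (auto intro: in_vimage_algebra)
  moreover have "X -` P \<inter> space M \<inter> (Y -` Q \<inter> space M) = {\<omega>\<in>space M. X \<omega> \<in> P \<and> Y \<omega> \<in> Q}"
    "X -` P \<inter> space M = {\<omega>\<in>space M. X \<omega> \<in> P}" "Y -` Q \<inter> space M = {\<omega>\<in>space M. Y \<omega> \<in> Q}"
    by auto
  ultimately show ?thesis by simp
qed

lemma (in prob_space) prob_trial_sequence:
  fixes \<xi> :: "nat \<Rightarrow> 'a \<Rightarrow> 'd"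
  assumes N: "N \<ge> 1" and ind: "indep_vars (\<lambda>_. count_space UNIV) \<xi> {1..N}"
    and p: "\<And>j l. j \<in> {1..N} \<Longrightarrow> \<P>(\<omega> in M. \<xi> j \<omega> = l) = p l"
    and f: "f \<in> {1..N} \<rightarrow>\<^sub>E UNIV"
  shows "\<P>(\<omega> in M. trial_sequence N \<xi> \<omega> = f) = (\<Prod>i\<in>{1..N}. p (f i))"
proof -
  have "trial_sequence N \<xi> \<omega> = f \<longleftrightarrow> (\<forall>i\<in>{1..N}. \<xi> i \<omega> = f i)" for \<omega>
  proof
    assume "\<forall>i\<in>{1..N}. \<xi> i \<omega> = f i"
    then show "trial_sequence N \<xi> \<omega> = f"
      using f by (intro PiE_ext[of _ "{1..N}" "\<lambda>_. UNIV"]) (auto simp: trial_sequence_def)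
  qed (auto simp: trial_sequence_def)
  \<comment> \<open>The bound \<open>N \<ge> 1\<close> makes the intersection nonempty-indexed, so
    that it lies inside \<open>space M\<close>.\<close>
  then have "{\<omega>\<in>space M. trial_sequence N \<xi> \<omega> = f} = (\<Inter>i\<in>{1..N}. \<xi> i -` {f i} \<inter> space M)"
    using N by auto
  also have "prob \<dots> = (\<Prod>i\<in>{1..N}. prob (\<xi> i -` {f i} \<inter> space M))"
    using N by (intro indep_varsD[OF ind]) auto
  also have "\<dots> = (\<Prod>i\<in>{1..N}. p (f i))"
    using p by (intro prod.cong) (auto simp: vimage_def Int_def conj_commute)
  finally show ?thesis .
qed

text \<open>A finite product of finite discrete spaces is discrete, so single sequences are
  measurable events.\<close>

lemma sequence_space_eq: "(sequence_space N :: (nat \<Rightarrow> 'd::finite) measure) = count_space ({1..N} \<rightarrow>\<^sub>E UNIV)"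
  by (rule count_space_PiM_finite) (auto intro: countable_finite)

lemma array_space_eq: "(array_space N :: (nat \<times> 'd::finite \<Rightarrow> bool) measure) = count_space ({1..N} \<times> UNIV \<rightarrow>\<^sub>E UNIV)"
  by (rule count_space_PiM_finite) (auto intro: countable_finite)

lemma count_vector_eq_iff:
  "count_vector N \<xi> \<omega> = x \<longleftrightarrow> trial_sequence N \<xi> \<omega> \<in> words {1..N} x"
proof -
  have "{i \<in> {1..N}. trial_sequence N \<xi> \<omega> i = l} = {i \<in> {1..N}. \<xi> i \<omega> = l}" for l
    by (auto simp: trial_sequence_def)
  then show ?thesis
    unfolding words_def fun_eq_iff count_vector_def by (auto simp: trial_sequence_def)
qed

text \<open>Once both sequences are fixed, the number of thinned matches depends on the coin array
  alone, which is what lets independence of the coins be applied. Each matched trial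
  \<open>j\<close> reads just the coin \<open>(j, f j)\<close>.\<close>

lemma card_thinned_trials:
  assumes "trial_sequence N \<xi> \<omega> = f" "trial_sequence N \<eta> \<omega> = g"
  shows "card (thinned_trials N \<xi> \<eta> B \<omega>)
    = card {jk \<in> (\<lambda>j. (j, f j)) ` {j\<in>{1..N}. f j = g j}. coin_array N B \<omega> jk}"
proof (rule bij_betw_same_card)
  have "\<xi> j \<omega> = f j" "\<eta> j \<omega> = g j" if "j \<in> {1..N}" for j
    using assms that by (auto simp: trial_sequence_def)
  then have eq: "thinned_trials N \<xi> \<eta> B \<omega> = {j\<in>{1..N}. f j = g j \<and> B j (f j) \<omega>}"
    by (auto simp: thinned_trials_def matched_trials_def)
  show "bij_betw (\<lambda>j. (j, f j)) (thinned_trials N \<xi> \<eta> B \<omega>)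
      {jk \<in> (\<lambda>j. (j, f j)) ` {j\<in>{1..N}. f j = g j}. coin_array N B \<omega> jk}"
    unfolding eq by (auto simp: bij_betw_def inj_on_def coin_array_def)
qed

text \<open>The event of given counts is a finite disjoint union over pairs \<open>(f, g)\<close>,
  each of the same probability. For a fixed pair, the coins read at the matched trials are
  independent, and a match with outcome \<open>k\<close> contributes
  \<open>1 + q (s - 1) / p k\<close>.\<close>

lemma joint_generating_function:
  fixes p :: "'d::finite \<Rightarrow> real" and \<xi> \<eta> :: "nat \<Rightarrow> 'a \<Rightarrow> 'd" and s :: real
  assumes M: "prob_space \<Omega>" and N: "N \<ge> 1"
    and \<xi>: "prob_space.indep_vars \<Omega> (\<lambda>_. count_space UNIV) \<xi> {1..N}"
    and \<eta>: "prob_space.indep_vars \<Omega> (\<lambda>_. count_space UNIV) \<eta> {1..N}"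
    and p\<xi>: "\<And>j l. j \<in> {1..N} \<Longrightarrow> \<P>(\<omega> in \<Omega>. \<xi> j \<omega> = l) = p l"
    and p\<eta>: "\<And>j l. j \<in> {1..N} \<Longrightarrow> \<P>(\<omega> in \<Omega>. \<eta> j \<omega> = l) = p l"
    and ind: "independent_elements \<Omega>
           (sequence_space N) (trial_sequence N \<xi>)
           (sequence_space N) (trial_sequence N \<eta>)"
    and B: "prob_space.indep_vars \<Omega> (\<lambda>_. count_space UNIV) (\<lambda>(j, k). B j k) ({1..N} \<times> UNIV)"
    and pB: "\<And>j k. j \<in> {1..N} \<Longrightarrow> \<P>(\<omega> in \<Omega>. B j k \<omega>) = q / p k"
    and indB: "independent_elements \<Omega>
           (sequence_space N \<Otimes>\<^sub>M sequence_space N)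
           (\<lambda>\<omega>. (trial_sequence N \<xi> \<omega>, trial_sequence N \<eta> \<omega>))
           (array_space N) (coin_array N B)"
  shows "(\<Sum>k\<le>N. s ^ k * \<P>(\<omega> in \<Omega>. card (thinned_trials N \<xi> \<eta> B \<omega>) = k \<and>
        count_vector N \<xi> \<omega> = x \<and> count_vector N \<eta> \<omega> = y))
    = (\<Prod>j\<in>UNIV. p j ^ x j) * (\<Prod>j\<in>UNIV. p j ^ y j) *
      (\<Sum>f\<in>words {1..N} x. \<Sum>g\<in>words {1..N} y.
        \<Prod>i\<in>{1..N}. 1 + q * (s - 1) * (if f i = g i then 1 / p (f i) else 0))"
    and "\<P>(\<omega> in \<Omega>. count_vector N \<xi> \<omega> = x \<and> count_vector N \<eta> \<omega> = y)
    = (\<Prod>j\<in>UNIV. p j ^ x j) * (\<Prod>j\<in>UNIV. p j ^ y j) * (card (words {1..N} x) * card (words {1..N} y))"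
proof -
  interpret prob_space \<Omega> by (rule M)
  let ?I = "{1..N}" and ?tx = "trial_sequence N \<xi>" and ?ty = "trial_sequence N \<eta>"
  let ?px = "\<Prod>j\<in>UNIV. p j ^ x j" and ?py = "\<Prod>j\<in>UNIV. p j ^ y j"
  define J where "J f g = (\<lambda>j. (j, f j)) ` {j\<in>?I. f j = g j}" for f g :: "nat \<Rightarrow> 'd"
  define V where "V f g \<omega> = card {jk\<in>J f g. coin_array N B \<omega> jk}" for f g \<omega>
  have wordsE: "f \<in> ?I \<rightarrow>\<^sub>E UNIV" if "f \<in> words ?I z" for f :: "nat \<Rightarrow> 'd" and z
    using that by (simp add: words_def)
  have meas: "(\<lambda>\<omega>. (?tx \<omega>, ?ty \<omega>)) \<in> measurable \<Omega> (sequence_space N \<Otimes>\<^sub>M sequence_space N)"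
    "coin_array N B \<in> measurable \<Omega> (array_space N)"
    using indB by (auto simp: independent_elements_def)
  have singleton_sets: "{f} \<in> sets (sequence_space N)" if "f \<in> ?I \<rightarrow>\<^sub>E UNIV" for f :: "nat \<Rightarrow> 'd"
    unfolding sequence_space_eq using that by simp
  have pair_sets: "{(f, g)} \<in> sets (sequence_space N \<Otimes>\<^sub>M sequence_space N)"
    if "f \<in> ?I \<rightarrow>\<^sub>E UNIV" "g \<in> ?I \<rightarrow>\<^sub>E UNIV" for f g :: "nat \<Rightarrow> 'd"
  proof -
    have "{f} \<times> {g} \<in> sets (sequence_space N \<Otimes>\<^sub>M sequence_space N)"
      using that by (intro pair_measureI singleton_sets)
    then show ?thesis by simp
  qed
  have pair: "\<P>(\<omega> in \<Omega>. (?tx \<omega>, ?ty \<omega>) \<in> {(f, g)}) = ?px * ?py"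
    if "f \<in> words ?I x" "g \<in> words ?I y" for f g
  proof -
    have "\<P>(\<omega> in \<Omega>. ?tx \<omega> \<in> {f} \<and> ?ty \<omega> \<in> {g}) = \<P>(\<omega> in \<Omega>. ?tx \<omega> \<in> {f}) * \<P>(\<omega> in \<Omega>. ?ty \<omega> \<in> {g})"
      using that by (intro independent_elements_prob[OF M ind] singleton_sets wordsE)
    moreover have "\<P>(\<omega> in \<Omega>. ?tx \<omega> = f) = ?px" "\<P>(\<omega> in \<Omega>. ?ty \<omega> = g) = ?py"
      using prob_trial_sequence[where p = p, OF N \<xi> p\<xi> wordsE[OF that(1)]]
        prob_trial_sequence[where p = p, OF N \<eta> p\<eta> wordsE[OF that(2)]]
        prod_words[OF _ that(1), of p] prod_words[OF _ that(2), of p] by simp_all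
    ultimately show ?thesis by simp
  qed
  \<comment> \<open>The condition \<open>V f g \<omega> = k\<close> as a set of coin arrays, the
    form to which independence of the array applies.\<close>
  define A where "A f g k = {b \<in> ?I \<times> UNIV \<rightarrow>\<^sub>E UNIV. card {jk\<in>J f g. b jk} = k}" for f g k
  have A_sets: "A f g k \<in> sets (array_space N)" for f g k
    unfolding array_space_eq by (auto simp: A_def)
  have A_iff: "coin_array N B \<omega> \<in> A f g k \<longleftrightarrow> V f g \<omega> = k" for f g k \<omega>
    by (auto simp: A_def V_def coin_array_def)
  have triple: "\<P>(\<omega> in \<Omega>. (?tx \<omega>, ?ty \<omega>) \<in> {(f, g)} \<and> V f g \<omega> = k) = ?px * ?py * \<P>(\<omega> in \<Omega>. V f g \<omega> = k)"
    if "f \<in> words ?I x" "g \<in> words ?I y" for f g k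
  proof -
    show ?thesis
      using independent_elements_prob[OF M indB pair_sets[OF that[THEN wordsE]] A_sets[of f g k]] pair[OF that]
      by (simp add: A_iff)
  qed
  have coins: "(\<Sum>k\<le>N. s ^ k * \<P>(\<omega> in \<Omega>. V f g \<omega> = k))
    = (\<Prod>i\<in>?I. 1 + q * (s - 1) * (if f i = g i then 1 / p (f i) else 0))" for f g
  proof -
    let ?B = "\<lambda>(j, k). B j k"
    have J: "finite (J f g)" "J f g \<subseteq> ?I \<times> UNIV"
      by (auto simp: J_def)
    have inj: "inj_on (\<lambda>j. (j, f j)) {j\<in>?I. f j = g j}"
      by (auto simp: inj_on_def)
    have "card (J f g) \<le> card {j\<in>?I. f j = g j}"
      unfolding J_def by (intro card_image_le) simp
    also have "\<dots> \<le> card ?I" by (intro card_mono) auto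
    finally have card: "card (J f g) \<le> N" by simp
    have V: "V f g \<omega> = card {jk\<in>J f g. ?B jk \<omega>}" for \<omega>
      unfolding V_def by (intro arg_cong[where f = card]) (auto simp: J_def coin_array_def)
    have "(\<Sum>k\<le>N. s ^ k * \<P>(\<omega> in \<Omega>. V f g \<omega> = k)) = (\<Prod>jk\<in>J f g. 1 + (s - 1) * \<P>(\<omega> in \<Omega>. ?B jk \<omega>))"
      unfolding V by (intro card_indep_generating_function J card indep_vars_subset[OF B])
    also have "\<dots> = (\<Prod>j\<in>{j\<in>?I. f j = g j}. 1 + q * (s - 1) * (1 / p (f j)))"
      unfolding J_def by (subst prod.reindex[OF inj]) (auto simp: pB intro!: prod.cong)
    \<comment> \<open>Unmatched trials enter with factor 1, which extends the product to all
      trials.\<close>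
    also have "\<dots> = (\<Prod>i\<in>?I. if f i = g i then 1 + q * (s - 1) * (1 / p (f i)) else 1)"
      by (rule prod.inter_filter) simp
    also have "\<dots> = (\<Prod>i\<in>?I. 1 + q * (s - 1) * (if f i = g i then 1 / p (f i) else 0))"
      by (intro prod.cong) auto
    finally show ?thesis .
  qed
  have fin: "finite (words ?I x \<times> words ?I y)"
    by (simp add: finite_words)
  \<comment> \<open>Kept general in \<open>Q\<close> and \<open>R\<close> to serve twice: for the
    number of thinned matches, and with \<open>True\<close> for the probability of the conditioning
    event.\<close>
  have split: "\<P>(\<omega> in \<Omega>. count_vector N \<xi> \<omega> = x \<and> count_vector N \<eta> \<omega> = y \<and> Q \<omega>)
      = (\<Sum>(f, g)\<in>words ?I x \<times> words ?I y. \<P>(\<omega> in \<Omega>. (?tx \<omega>, ?ty \<omega>) \<in> {(f, g)} \<and> R f g \<omega>))"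
    if R: "\<And>\<omega> f g. ?tx \<omega> = f \<Longrightarrow> ?ty \<omega> = g \<Longrightarrow> Q \<omega> = R f g \<omega>"
      and ev: "\<And>f g. f \<in> words ?I x \<Longrightarrow> g \<in> words ?I y \<Longrightarrow> {\<omega>\<in>space \<Omega>. (?tx \<omega>, ?ty \<omega>) \<in> {(f, g)} \<and> R f g \<omega>} \<in> events"
    for Q R
  proof -
    let ?E = "\<lambda>(f, g). {\<omega>\<in>space \<Omega>. (?tx \<omega>, ?ty \<omega>) \<in> {(f, g)} \<and> R f g \<omega>}"
    have union: "{\<omega>\<in>space \<Omega>. count_vector N \<xi> \<omega> = x \<and> count_vector N \<eta> \<omega> = y \<and> Q \<omega>} = (\<Union>fg\<in>words ?I x \<times> words ?I y. ?E fg)"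
      (is "?L = ?R")
    proof (intro set_eqI iffI)
      fix \<omega> assume "\<omega> \<in> ?L"
      then have "(?tx \<omega>, ?ty \<omega>) \<in> words ?I x \<times> words ?I y" "\<omega> \<in> ?E (?tx \<omega>, ?ty \<omega>)"
        using R[of \<omega>, OF refl refl] unfolding count_vector_eq_iff by simp_all
      then show "\<omega> \<in> ?R" by (rule UN_I)
    next
      fix \<omega> assume "\<omega> \<in> ?R"
      then obtain f g where "f \<in> words ?I x" "g \<in> words ?I y" "\<omega> \<in> ?E (f, g)" by blast
      then show "\<omega> \<in> ?L"
        using R[of \<omega> f g] unfolding count_vector_eq_iff by simp
    qed
    have "prob (\<Union>fg\<in>words ?I x \<times> words ?I y. ?E fg) = (\<Sum>fg\<in>words ?I x \<times> words ?I y. prob (?E fg))"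
      using ev by (intro finite_measure_finite_Union fin) (auto simp: disjoint_family_on_def)
    then show ?thesis unfolding union by (simp only: case_prod_unfold)
  qed
  have pair_event: "{\<omega>\<in>space \<Omega>. (?tx \<omega>, ?ty \<omega>) \<in> {(f, g)}} \<in> events"
    if "f \<in> words ?I x" "g \<in> words ?I y" for f g
    using measurable_sets[OF meas(1) pair_sets[OF that[THEN wordsE]]]
    by (simp add: vimage_def Int_def conj_commute)
  have V_event: "{\<omega>\<in>space \<Omega>. V f g \<omega> = k} \<in> events" for f g k
    using measurable_sets[OF meas(2) A_sets[of f g k]]
    by (simp add: vimage_def Int_def conj_commute A_iff)
  have "\<P>(\<omega> in \<Omega>. card (thinned_trials N \<xi> \<eta> B \<omega>) = k \<and> count_vector N \<xi> \<omega> = x \<and> count_vector N \<eta> \<omega> = y)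
    = ?px * ?py * (\<Sum>(f, g)\<in>words ?I x \<times> words ?I y. \<P>(\<omega> in \<Omega>. V f g \<omega> = k))" for k
  proof -
    have "\<P>(\<omega> in \<Omega>. count_vector N \<xi> \<omega> = x \<and> count_vector N \<eta> \<omega> = y \<and> card (thinned_trials N \<xi> \<eta> B \<omega>) = k)
      = (\<Sum>(f, g)\<in>words ?I x \<times> words ?I y. \<P>(\<omega> in \<Omega>. (?tx \<omega>, ?ty \<omega>) \<in> {(f, g)} \<and> V f g \<omega> = k))"
    proof (rule split)
      show "(card (thinned_trials N \<xi> \<eta> B \<omega>) = k) = (V f g \<omega> = k)" if "?tx \<omega> = f" "?ty \<omega> = g" for \<omega> f g
        unfolding card_thinned_trials[where B = B, OF that] V_def J_def ..
      show "{\<omega>\<in>space \<Omega>. (?tx \<omega>, ?ty \<omega>) \<in> {(f, g)} \<and> V f g \<omega> = k} \<in> events"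
        if "f \<in> words ?I x" "g \<in> words ?I y" for f g
        by (intro sets.sets_Collect_conj pair_event that V_event)
    qed
    also have "\<dots> = (\<Sum>(f, g)\<in>words ?I x \<times> words ?I y. ?px * ?py * \<P>(\<omega> in \<Omega>. V f g \<omega> = k))"
      by (intro sum.cong refl) (auto simp: triple simp del: insert_iff)
    finally show ?thesis by (simp add: sum_distrib_left case_prod_unfold conj_ac)
  qed
  then have "(\<Sum>k\<le>N. s ^ k * \<P>(\<omega> in \<Omega>. card (thinned_trials N \<xi> \<eta> B \<omega>) = k \<and>
        count_vector N \<xi> \<omega> = x \<and> count_vector N \<eta> \<omega> = y))
    = (\<Sum>k\<le>N. \<Sum>(f, g)\<in>words ?I x \<times> words ?I y. ?px * ?py * (s ^ k * \<P>(\<omega> in \<Omega>. V f g \<omega> = k)))"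
    by (simp add: sum_distrib_left case_prod_unfold mult_ac)
  also have "\<dots> = (\<Sum>(f, g)\<in>words ?I x \<times> words ?I y. ?px * ?py * (\<Sum>k\<le>N. s ^ k * \<P>(\<omega> in \<Omega>. V f g \<omega> = k)))"
    by (subst sum.swap) (simp add: sum_distrib_left case_prod_unfold)
  finally show "(\<Sum>k\<le>N. s ^ k * \<P>(\<omega> in \<Omega>. card (thinned_trials N \<xi> \<eta> B \<omega>) = k \<and>
        count_vector N \<xi> \<omega> = x \<and> count_vector N \<eta> \<omega> = y))
    = ?px * ?py * (\<Sum>f\<in>words ?I x. \<Sum>g\<in>words ?I y.
        \<Prod>i\<in>?I. 1 + q * (s - 1) * (if f i = g i then 1 / p (f i) else 0))"
    unfolding coins by (simp add: sum.cartesian_product sum_distrib_left case_prod_unfold)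
  have "\<P>(\<omega> in \<Omega>. count_vector N \<xi> \<omega> = x \<and> count_vector N \<eta> \<omega> = y \<and> True)
      = (\<Sum>(f, g)\<in>words ?I x \<times> words ?I y. \<P>(\<omega> in \<Omega>. (?tx \<omega>, ?ty \<omega>) \<in> {(f, g)} \<and> True))"
    by (rule split) (simp_all only: simp_thms pair_event)
  also have "\<dots> = (\<Sum>(f, g)\<in>words ?I x \<times> words ?I y. ?px * ?py)"
    by (intro sum.cong refl) (auto simp: pair simp del: insert_iff)
  finally show "\<P>(\<omega> in \<Omega>. count_vector N \<xi> \<omega> = x \<and> count_vector N \<eta> \<omega> = y)
    = ?px * ?py * (card (words ?I x) * card (words ?I y))"
    by (simp add: card_cartesian_product)
qed

section \<open>Comparison of the two generating functions\<close>

theorem theorem5: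
  fixes N :: nat and p :: "'d::finite \<Rightarrow> real" and q :: real
    and \<Omega> :: "'a measure" and S :: "'b measure"
    and \<xi> \<eta> :: "nat \<Rightarrow> 'a \<Rightarrow> 'd" and B :: "nat \<Rightarrow> 'd \<Rightarrow> 'a \<Rightarrow> bool"
    and u :: "nat \<Rightarrow> 'd \<Rightarrow> real" and x y :: "'d \<Rightarrow> nat" and Z :: "'b \<Rightarrow> nat"
  assumes "N \<ge> 1" and "CARD('d) \<ge> 2"
    and "\<And>k. p k > 0" and "(\<Sum>k\<in>UNIV. p k) = 1"
    and "0 < q" and "q \<le> Min (range p)"
    and "orthonormal_system p u"
    and "prob_space \<Omega>"
    and "prob_space.indep_vars \<Omega> (\<lambda>_. count_space UNIV) \<xi> {1..N}"
    and "prob_space.indep_vars \<Omega> (\<lambda>_. count_space UNIV) \<eta> {1..N}"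
    and "\<And>j l. j \<in> {1..N} \<Longrightarrow> \<P>(\<omega> in \<Omega>. \<xi> j \<omega> = l) = p l"
    and "\<And>j l. j \<in> {1..N} \<Longrightarrow> \<P>(\<omega> in \<Omega>. \<eta> j \<omega> = l) = p l"
    and "independent_elements \<Omega>
           (sequence_space N) (trial_sequence N \<xi>)
           (sequence_space N) (trial_sequence N \<eta>)"
    and "prob_space.indep_vars \<Omega> (\<lambda>_. count_space UNIV) (\<lambda>(j, k). B j k) ({1..N} \<times> UNIV)"
    and "\<And>j k. j \<in> {1..N} \<Longrightarrow> \<P>(\<omega> in \<Omega>. B j k \<omega>) = q / p k"
    and "independent_elements \<Omega>
           (sequence_space N \<Otimes>\<^sub>M sequence_space N)
           (\<lambda>\<omega>. (trial_sequence N \<xi> \<omega>, trial_sequence N \<eta> \<omega>))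
           (array_space N) (coin_array N B)"
    and "x \<in> multinomial_support N" and "y \<in> multinomial_support N"
    and "prob_space S" and "Z \<in> measurable S (count_space UNIV)"
    and "\<And>z. \<P>(\<omega> in S. Z \<omega> = z) = phi N p u q x y z"
  shows "\<forall>k::int. \<P>(\<omega> in S. int N - int (Z \<omega>) = k) =
     \<P>(\<omega> in \<Omega>. int (card (thinned_trials N \<xi> \<eta> B \<omega>)) = k
        \<bar> count_vector N \<xi> \<omega> = x \<and> count_vector N \<eta> \<omega> = y)"
proof
  fix k :: int
  interpret S: prob_space S by fact
  note joint = joint_generating_function[where p = p and q = q and x = x and y = y, OF assms(8) assms(1) assms(9,10) assms(11) assms(12)
      assms(13,14) assms(15) assms(16)]
  let ?C = "\<lambda>\<omega>. count_vector N \<xi> \<omega> = x \<and> count_vector N \<eta> \<omega> = y"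
  let ?T = "\<lambda>\<omega>. card (thinned_trials N \<xi> \<eta> B \<omega>)"
  \<comment> \<open>The probability of the conditioning event, a product of two multinomial masses;
    it is positive because \<open>x\<close> and \<open>y\<close> lie in the support.\<close>
  let ?w = "(\<Prod>j\<in>UNIV. p j ^ x j) * (\<Prod>j\<in>UNIV. p j ^ y j) *
    (real (card (words {1..N} x)) * real (card (words {1..N} y)))"
  \<comment> \<open>With at least two categories, each of positive probability, every
    \<open>p a\<close> is below 1. This makes the success probability \<open>1 - q\<close> nonzero,
    as the Krawtchouk transform requires.\<close>
  have q: "q < 1"
  proof -
    obtain a b :: 'd where ab: "a \<noteq> b"
      using assms(2) by (metis One_nat_def Suc_1 card_2_iff' card_le_Suc0_iff_eq finite not_less_eq_eq UNIV_I)
    have "p a + p b = sum p {a, b}" using ab by simp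
    also have "\<dots> \<le> sum p UNIV"
      using assms(3) by (intro sum_mono2) (auto intro: less_imp_le)
    finally have "p a < 1" using assms(3)[of b] assms(4) by simp
    moreover have "q \<le> p a"
      using assms(6) by (rule order_trans) (auto intro: Min_le)
    ultimately show ?thesis by simp
  qed
  have words_pos: "card (words {1..N} z) > 0" if "z \<in> multinomial_support N" for z :: "'d \<Rightarrow> nat"
  proof -
    have "real (card (words {1..N} z)) > 0"
      using that by (subst card_words) (auto intro!: divide_pos_pos prod_pos)
    then show ?thesis by simp
  qed
  have w: "?w > 0"
    using words_pos[OF assms(17)] words_pos[OF assms(18)] assms(3)
    by (intro mult_pos_pos prod_pos zero_less_power) auto
  have C: "\<P>(\<omega> in \<Omega>. ?C \<omega>) = ?w"
    using joint(2) by simp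
  have "(\<Sum>k\<le>N. \<P>(\<omega> in \<Omega>. ?T \<omega> = k \<and> ?C \<omega>) * s ^ k) = (\<Sum>k\<le>N. ?w * phi N p u q x y (N - k) * s ^ k)" for s
  proof -
    have "(\<Sum>k\<le>N. \<P>(\<omega> in \<Omega>. ?T \<omega> = k \<and> ?C \<omega>) * s ^ k) = ?w * (\<Sum>k\<le>N. phi N p u q x y (N - k) * s ^ k)"
      using joint(1)[where s = s] sum_words_matching[where I = "{1..N}" and t = "q * (s - 1)" and x = x and y = y, OF _ assms(3,7)]
        phi_generating_function[OF q, of N p u x y s] by (simp add: mult_ac)
    then show ?thesis by (simp add: sum_distrib_left mult_ac)
  qed
  \<comment> \<open>Both sides are polynomials in \<open>s\<close> of degree at most
    \<open>N\<close> that agree for every real \<open>s\<close>, so their coefficients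
    agree.\<close>
  then have coeff: "\<P>(\<omega> in \<Omega>. ?T \<omega> = k \<and> ?C \<omega>) = ?w * phi N p u q x y (N - k)" if "k \<le> N" for k
    using polyfun_eq_coeffs[of "\<lambda>k. \<P>(\<omega> in \<Omega>. ?T \<omega> = k \<and> ?C \<omega>)" N "\<lambda>k. ?w * phi N p u q x y (N - k)"] that
    by blast
  have T_le: "?T \<omega> \<le> N" for \<omega>
  proof -
    have "thinned_trials N \<xi> \<eta> B \<omega> \<subseteq> {1..N}"
      by (auto simp: thinned_trials_def matched_trials_def)
    then have "?T \<omega> \<le> card {1..N}" by (intro card_mono) simp
    then show ?thesis by simp
  qed
  have cond: "\<P>(\<omega> in \<Omega>. int (?T \<omega>) = k \<bar> ?C \<omega>) = \<P>(\<omega> in \<Omega>. int (?T \<omega>) = k \<and> ?C \<omega>) / ?w"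
    by (simp only: cond_prob_def C)
  show "\<P>(\<omega> in S. int N - int (Z \<omega>) = k) = \<P>(\<omega> in \<Omega>. int (?T \<omega>) = k \<bar> ?C \<omega>)"
  proof (cases "0 \<le> k \<and> k \<le> int N")
    case True
    then obtain m where m: "k = int m" "m \<le> N"
      by (metis nat_le_iff nat_0_le)
    have "int N - int (Z \<omega>) = k \<longleftrightarrow> Z \<omega> = N - m" for \<omega> using m by auto
    then have "\<P>(\<omega> in S. int N - int (Z \<omega>) = k) = phi N p u q x y (N - m)"
      using assms(21) by simp
    moreover have "\<P>(\<omega> in \<Omega>. int (?T \<omega>) = k \<and> ?C \<omega>) = ?w * phi N p u q x y (N - m)"
      using coeff[OF m(2)] m(1) by simp
    ultimately show ?thesis
      unfolding cond by (simp only: nonzero_mult_div_cancel_left[OF less_imp_neq[OF w, symmetric]])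
  next
    case False
    then have "{\<omega>\<in>space \<Omega>. int (?T \<omega>) = k \<and> ?C \<omega>} = {}"
      using T_le by auto
    then have "\<P>(\<omega> in \<Omega>. int (?T \<omega>) = k \<bar> ?C \<omega>) = 0"
      unfolding cond by (simp only: measure_empty div_0)
    moreover have "\<P>(\<omega> in S. int N - int (Z \<omega>) = k) = 0"
    \<comment> \<open>A negative \<open>k\<close> would force \<open>Z\<close> above
      \<open>N\<close>, where the binomial coefficient in \<open>phi\<close> vanishes; a
      \<open>k\<close> above \<open>N\<close> is impossible because \<open>Z\<close> is
      nonnegative.\<close>
    proof (cases "k < 0")
      case True
      then have "{\<omega>\<in>space S. int N - int (Z \<omega>) = k} = {\<omega>\<in>space S. Z \<omega> = nat (int N - k)}"
        by auto
      moreover have "nat (int N - k) > N" using True by simp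
      ultimately show ?thesis
        using assms(21)[of "nat (int N - k)"] by (simp add: phi_def)
    next
      case k: False
      then have "{\<omega>\<in>space S. int N - int (Z \<omega>) = k} = {}"
        using False by auto
      then show ?thesis by (simp only: measure_empty)
    qed
    ultimately show ?thesis by simp
  qed
qed

end
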